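(* Let $1<p\le 2$ and let $(w_k)_{k\in\mathbf{N}}$ satisfy $w_k\ge w_0>0$ for all $k$. Let $u^+\in\ell^2$ with $Ku^+=g^+$, and suppose that there exists $\theta\in Y$ such that $w_k\operatorname{sgn}(u^+_k)|u^+_k|^{p-1}=(K^*\theta)_k$ for all $k$. For $\delta>0$ let $g^\delta\in Y$ with $\|g^+-g^\delta\|_Y\le\delta$, and let $u^{\alpha,\delta}$ be a minimizer over $u\in\ell^2$ of $$\Psi(u)=\|Ku-g^\delta\|_Y^2+\alpha\sum_k w_k|u_k|^p .$$ Then for the choice $\alpha=\alpha(\delta)\sim\delta$ it holds $$\|u^{\alpha,\delta}-u^+\|_{\ell^2}=\mathcal{O}(\sqrt{\delta})\quad\text{for }\delta\to 0.$$
   Context: $Y$ is a real Hilbert space, $\ell^2$ is the space of real square-summable sequences indexed by $\mathbf{N}$, and $K:\ell^2\to Y$ is a bounded linear operator with Hilbert space adjoint $K^*:Y\to\ell^2$. $g^+\in Y$ is the exact data, $g^\delta\in Y$ the noisy data, $\alpha>0$ the regularization parameter. $\Psi$ takes the value $+\infty$ where the penalty sum diverges. $\operatorname{sgn}$ is the usual sign with $\operatorname{sgn}(0)=0$. $\alpha\sim\delta$ means that there are constants $0<c\le C$ with $c\,\delta\le\alpha(\delta)\le C\,\delta$ for all small $\delta$. *)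

theory Defs
  imports "HOL-Analysis.Analysis"
begin

typedef ell2 = "{x :: nat \<Rightarrow> real. summable (\<lambda>k. (x k)\<^sup>2)}"
  morphisms ell2_nth Abs_ell2
  by (rule exI[of _ "\<lambda>_. 0"]) simp

setup_lifting type_definition_ell2

notation ell2_nth (infixl "$$" 90)

lemma ell2_eqI: "(\<And>k. x $$ k = y $$ k) \<Longrightarrow> x = y"
  by (metis ell2_nth_inject ext)

lemma summable_ell2_power2: "summable (\<lambda>k. (x $$ k)\<^sup>2)"
  using ell2_nth[of x] by simp

lemma square_summable_ell2E:
  assumes "summable (\<lambda>k. (f k)\<^sup>2)"
  obtains x where "\<And>k. x $$ k = f k"
  using assms that[of "Abs_ell2 f"] by (simp add: Abs_ell2_inverse)

lemma square_summable_mult: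
  fixes f g :: "nat \<Rightarrow> real"
  assumes f: "summable (\<lambda>k. (f k)\<^sup>2)" and g: "summable (\<lambda>k. (g k)\<^sup>2)"
  shows "summable (\<lambda>k. f k * g k)"
proof (rule summable_comparison_test'[OF summable_add[OF f g], of 0])
  fix n
  have "0 \<le> (\<bar>f n\<bar> - \<bar>g n\<bar>)\<^sup>2" "0 \<le> (\<bar>f n\<bar>)\<^sup>2 + (\<bar>g n\<bar>)\<^sup>2" by simp_all
  then have "\<bar>f n\<bar> * \<bar>g n\<bar> \<le> \<bar>f n\<bar>\<^sup>2 + \<bar>g n\<bar>\<^sup>2"
    unfolding power2_diff by linarith
  then show "norm (f n * g n) \<le> (f n)\<^sup>2 + (g n)\<^sup>2" by (simp add: abs_mult)
qed

lemma square_summable_add: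
  fixes f g :: "nat \<Rightarrow> real"
  assumes f: "summable (\<lambda>k. (f k)\<^sup>2)" and g: "summable (\<lambda>k. (g k)\<^sup>2)"
  shows "summable (\<lambda>k. (f k + g k)\<^sup>2)"
proof -
  have "summable (\<lambda>k. ((f k)\<^sup>2 + (g k)\<^sup>2) + 2 * (f k * g k))"
    by (intro summable_add summable_mult f g square_summable_mult)
  then show ?thesis by (simp add: power2_sum mult.assoc)
qed

instantiation ell2 :: real_vector
begin

lift_definition zero_ell2 :: ell2 is "\<lambda>_. 0" by simp
lift_definition plus_ell2 :: "ell2 \<Rightarrow> ell2 \<Rightarrow> ell2" is "\<lambda>x y k. x k + y k"
  by (rule square_summable_add)
lift_definition uminus_ell2 :: "ell2 \<Rightarrow> ell2" is "\<lambda>x k. - x k" by simp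
lift_definition minus_ell2 :: "ell2 \<Rightarrow> ell2 \<Rightarrow> ell2" is "\<lambda>x y k. x k - y k"
  using square_summable_add[where g = "\<lambda>k. - g k" for g] by simp
lift_definition scaleR_ell2 :: "real \<Rightarrow> ell2 \<Rightarrow> ell2" is "\<lambda>c x k. c * x k"
  by (simp add: power_mult_distrib summable_mult)

instance
  by standard (transfer; simp add: fun_eq_iff algebra_simps)+

end

lemmas ell2_nth_simps [simp] =
  zero_ell2.rep_eq plus_ell2.rep_eq uminus_ell2.rep_eq minus_ell2.rep_eq scaleR_ell2.rep_eq

lemma summable_ell2_mult: "summable (\<lambda>k. (x $$ k) * (y $$ k))"
  by (intro square_summable_mult summable_ell2_power2)

instantiation ell2 :: real_inner
begin

definition inner_ell2 :: "ell2 \<Rightarrow> ell2 \<Rightarrow> real"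
  where "inner_ell2 x y = (\<Sum>k. (x $$ k) * (y $$ k))"
definition norm_ell2 :: "ell2 \<Rightarrow> real"
  where "norm_ell2 x = sqrt (x \<bullet> x)"
definition sgn_ell2 :: "ell2 \<Rightarrow> ell2"
  where "sgn_ell2 x = x /\<^sub>R norm x"
definition dist_ell2 :: "ell2 \<Rightarrow> ell2 \<Rightarrow> real"
  where "dist_ell2 x y = norm (x - y)"
definition uniformity_ell2 :: "(ell2 \<times> ell2) filter"
  where "uniformity_ell2 = (INF e\<in>{0<..}. principal {(x, y). dist x y < e})"
definition open_ell2 :: "ell2 set \<Rightarrow> bool"
  where "open_ell2 U = (\<forall>x\<in>U. \<forall>\<^sub>F (x', y) in uniformity. x' = x \<longrightarrow> y \<in> U)"

instance
proof
  fix x y z :: ell2 and c :: real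
  show "x \<bullet> y = y \<bullet> x"
    by (simp add: inner_ell2_def mult.commute)
  show "(x + y) \<bullet> z = x \<bullet> z + y \<bullet> z"
    by (simp add: inner_ell2_def distrib_right suminf_add summable_ell2_mult)
  show "(c *\<^sub>R x) \<bullet> y = c * (x \<bullet> y)"
    by (simp add: inner_ell2_def mult.assoc suminf_mult summable_ell2_mult)
  show "0 \<le> x \<bullet> x"
    by (simp add: inner_ell2_def suminf_nonneg summable_ell2_mult)
  show "x \<bullet> x = 0 \<longleftrightarrow> x = 0"
  proof
    assume "x \<bullet> x = 0"
    then have "(x $$ k) * (x $$ k) = 0" for k
      unfolding inner_ell2_def
      by (subst (asm) suminf_eq_zero_iff) (auto simp: summable_ell2_mult)
    then show "x = 0" by (intro ell2_eqI) simp
  qed (simp add: inner_ell2_def)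
qed (rule norm_ell2_def sgn_ell2_def dist_ell2_def uniformity_ell2_def open_ell2_def)+

end

lemma norm_ell2_sq: "(norm (x :: ell2))\<^sup>2 = (\<Sum>k. (x $$ k)\<^sup>2)"
  unfolding power2_norm_eq_inner inner_ell2_def by (simp add: power2_eq_square)

lemma sum_ell2_le_norm: "finite A \<Longrightarrow> (\<Sum>k\<in>A. (x $$ k)\<^sup>2) \<le> (norm x)\<^sup>2"
  unfolding norm_ell2_sq by (intro sum_le_suminf summable_ell2_power2) auto

lemma abs_ell2_nth_le_norm: "\<bar>x $$ k\<bar> \<le> norm x"
  by (rule power2_le_imp_le) (use sum_ell2_le_norm[of "{k}" x] in simp_all)

lemma square_summableI_bounded:
  fixes f :: "nat \<Rightarrow> real"
  assumes "\<And>n. (\<Sum>k<n. (f k)\<^sup>2) \<le> B"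
  shows "summable (\<lambda>k. (f k)\<^sup>2)"
  by (rule summableI_nonneg_bounded[of _ B]) (simp_all add: assms)

instance ell2 :: complete_space
proof
  fix X :: "nat \<Rightarrow> ell2"
  assume X: "Cauchy X"
  have "Cauchy (\<lambda>n. X n $$ k)" for k
  proof (rule CauchyI)
    fix e :: real assume "0 < e"
    then obtain M where M: "\<And>m n. M \<le> m \<Longrightarrow> M \<le> n \<Longrightarrow> norm (X m - X n) < e"
      using CauchyD[OF X] by blast
    show "\<exists>M. \<forall>m\<ge>M. \<forall>n\<ge>M. norm (X m $$ k - X n $$ k) < e"
    proof (intro exI[of _ M] allI impI)
      fix m n assume "M \<le> m" "M \<le> n"
      then show "norm (X m $$ k - X n $$ k) < e"
        using M[of m n] abs_ell2_nth_le_norm[of "X m - X n" k] by simp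
    qed
  qed
  then have l: "(\<lambda>n. X n $$ k) \<longlonglongrightarrow> lim (\<lambda>n. X n $$ k)" for k
    by (simp add: Cauchy_convergent_iff convergent_LIMSEQ_iff)
  define l where "l k = lim (\<lambda>n. X n $$ k)" for k
  note l = l[folded l_def]
  have tail: "\<exists>M. \<forall>m\<ge>M. \<forall>N. (\<Sum>k<N. (X m $$ k - l k)\<^sup>2) \<le> e\<^sup>2" if e: "0 < e" for e
  proof -
    obtain M where M: "\<And>m n. M \<le> m \<Longrightarrow> M \<le> n \<Longrightarrow> norm (X m - X n) < e"
      using CauchyD[OF X e] by blast
    have "(\<Sum>k<N. (X m $$ k - l k)\<^sup>2) \<le> e\<^sup>2" if m: "M \<le> m" for m N
    proof (rule tendsto_upperbound)
      show "(\<lambda>n. \<Sum>k<N. (X m $$ k - X n $$ k)\<^sup>2) \<longlonglongrightarrow> (\<Sum>k<N. (X m $$ k - l k)\<^sup>2)"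
        by (intro tendsto_intros l)
      show "\<forall>\<^sub>F n in sequentially. (\<Sum>k<N. (X m $$ k - X n $$ k)\<^sup>2) \<le> e\<^sup>2"
      proof (rule eventually_sequentiallyI)
        fix n assume "M \<le> n"
        then have "(norm (X m - X n))\<^sup>2 \<le> e\<^sup>2"
          using M[OF m, of n] by (intro power_mono) auto
        then show "(\<Sum>k<N. (X m $$ k - X n $$ k)\<^sup>2) \<le> e\<^sup>2"
          using sum_ell2_le_norm[of "{..<N}" "X m - X n"] by simp
      qed
    qed simp
    then show ?thesis by blast
  qed
  obtain M where M: "\<And>N. (\<Sum>k<N. (X M $$ k - l k)\<^sup>2) \<le> 1\<^sup>2"
    using tail[OF zero_less_one] by blast
  have "summable (\<lambda>k. (- (X M $$ k - l k))\<^sup>2)"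
    unfolding power2_minus by (rule square_summableI_bounded[OF M])
  from square_summable_add[OF summable_ell2_power2[of "X M"] this]
  have "summable (\<lambda>k. (l k)\<^sup>2)" by simp
  then obtain L where L: "\<And>k. L $$ k = l k"
    using square_summable_ell2E by blast
  have "X \<longlonglongrightarrow> L"
  proof (rule LIMSEQ_I)
    fix e :: real assume e: "0 < e"
    then obtain M where M: "\<And>m N. M \<le> m \<Longrightarrow> (\<Sum>k<N. (X m $$ k - l k)\<^sup>2) \<le> (e/2)\<^sup>2"
      using tail[OF half_gt_zero[OF e]] by blast
    have "norm (X m - L) < e" if "M \<le> m" for m
    proof -
      have "(norm (X m - L))\<^sup>2 \<le> (e/2)\<^sup>2"
        unfolding norm_ell2_sq
        by (rule suminf_le_const[OF summable_ell2_power2]) (use M[OF that] L in simp)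
      then have "norm (X m - L) \<le> e/2"
        by (rule power2_le_imp_le) (use e in simp)
      then show ?thesis using e by simp
    qed
    then show "\<exists>M. \<forall>m\<ge>M. norm (X m - L) < e" by blast
  qed
  then show "convergent X" by (rule convergentI)
qed

text \<open>The library constant \<^const>\<open>adjoint\<close> is defined by choice, and its
  characteristic property is proved there for Euclidean spaces only. The following lemma shows that
  it is the Hilbert space adjoint for every bounded operator on \<open>\<ell>\<^sup>2\<close>.\<close>

lemma adjoint_ell2_works:
  fixes K :: "ell2 \<Rightarrow> 'y::real_inner"
  assumes K: "bounded_linear K"
  shows "K x \<bullet> y = x \<bullet> adjoint K y"
proof -
  interpret K: bounded_linear K by (rule K)
  define e where "e k = Abs_ell2 (\<lambda>j. if j = k then 1 else 0)" for k
  have e: "e k $$ j = (if j = k then 1 else 0)" for k j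
  proof -
    have "summable (\<lambda>j. (if j = k then 1 else 0 :: real)\<^sup>2)"
      by (rule summable_finite[of "{k}"]) auto
    then show ?thesis unfolding e_def by (simp add: Abs_ell2_inverse)
  qed
  have nth_sum: "(\<Sum>k<n. f k *\<^sub>R e k) $$ j = (if j < n then f j else 0)" for f n j
    by (induction n) (auto simp: e less_Suc_eq)
  have "\<exists>a. \<forall>x. K x \<bullet> y = x \<bullet> a" for y
  proof -
    define b where "b k = K (e k) \<bullet> y" for k
    have fin: "K (\<Sum>k<n. f k *\<^sub>R e k) \<bullet> y = (\<Sum>k<n. f k * b k)" for f n
      by (simp add: K.sum K.scaleR inner_sum_left b_def)
    obtain B where B: "\<And>x. norm (K x) \<le> norm x * B" "0 \<le> B"
      using K.nonneg_bounded by blast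
    have "(\<Sum>k<n. (b k)\<^sup>2) \<le> (B * norm y)\<^sup>2" for n
    proof -
      define s where "s = (\<Sum>k<n. b k *\<^sub>R e k)"
      have "(norm s)\<^sup>2 = (\<Sum>k<n. (b k)\<^sup>2)"
        unfolding norm_ell2_sq s_def nth_sum
        by (subst suminf_finite[of "{..<n}"]) auto
      moreover have "(\<Sum>k<n. (b k)\<^sup>2) = K s \<bullet> y"
        unfolding s_def fin by (simp add: power2_eq_square)
      moreover have "K s \<bullet> y \<le> norm s * (B * norm y)"
        using norm_cauchy_schwarz[of "K s" y] mult_right_mono[OF B(1)[of s], of "norm y"]
        by (simp add: mult.assoc)
      ultimately have *: "(norm s)\<^sup>2 = (\<Sum>k<n. (b k)\<^sup>2)" "norm s * norm s \<le> norm s * (B * norm y)"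
        by (simp_all add: power2_eq_square)
      have "norm s \<le> B * norm y"
        using *(2) B(2) by (cases "norm s = 0") (auto simp: mult_le_cancel_left)
      then have "(norm s)\<^sup>2 \<le> (B * norm y)\<^sup>2" by (intro power_mono) auto
      then show ?thesis by (simp add: *(1))
    qed
    then have "summable (\<lambda>k. (b k)\<^sup>2)" by (rule square_summableI_bounded)
    then obtain a where a: "\<And>k. a $$ k = b k"
      using square_summable_ell2E by blast
    have "K x \<bullet> y = x \<bullet> a" for x
    proof -
      have "(\<lambda>n. \<Sum>k<n. (x $$ k) *\<^sub>R e k) \<longlonglongrightarrow> x"
      proof -
        have "(\<lambda>n. (norm (x - (\<Sum>k<n. (x $$ k) *\<^sub>R e k)))\<^sup>2) \<longlonglongrightarrow> 0"
        proof -
          have "(norm (x - (\<Sum>k<n. (x $$ k) *\<^sub>R e k)))\<^sup>2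
              = (\<Sum>k. (x $$ k)\<^sup>2) - (\<Sum>k<n. (x $$ k)\<^sup>2)" for n
          proof -
            have "(norm (x - (\<Sum>k<n. (x $$ k) *\<^sub>R e k)))\<^sup>2
                = (\<Sum>k. (x $$ k)\<^sup>2 - (if k < n then (x $$ k)\<^sup>2 else 0))"
              unfolding norm_ell2_sq by (rule arg_cong[where f = suminf]) (auto simp: nth_sum)
            also have "\<dots> = (\<Sum>k. (x $$ k)\<^sup>2) - (\<Sum>k. if k < n then (x $$ k)\<^sup>2 else 0)"
              by (rule suminf_diff[symmetric])
                 (auto intro: summable_ell2_power2 summable_finite[of "{..<n}"])
            also have "(\<Sum>k. if k < n then (x $$ k)\<^sup>2 else 0) = (\<Sum>k<n. (x $$ k)\<^sup>2)"
              by (subst suminf_finite[of "{..<n}"]) auto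
            finally show ?thesis .
          qed
          moreover have "(\<lambda>n. (\<Sum>k. (x $$ k)\<^sup>2) - (\<Sum>k<n. (x $$ k)\<^sup>2))
              \<longlonglongrightarrow> (\<Sum>k. (x $$ k)\<^sup>2) - (\<Sum>k. (x $$ k)\<^sup>2)"
            by (intro tendsto_intros summable_LIMSEQ summable_ell2_power2)
          ultimately show ?thesis by simp
        qed
        from tendsto_real_sqrt[OF this] have "(\<lambda>n. norm (x - (\<Sum>k<n. (x $$ k) *\<^sub>R e k))) \<longlonglongrightarrow> 0"
          by simp
        then show ?thesis
          by (subst tendsto_dist_iff) (simp add: dist_norm norm_minus_commute)
      qed
      then have "(\<lambda>n. K (\<Sum>k<n. (x $$ k) *\<^sub>R e k) \<bullet> y) \<longlonglongrightarrow> K x \<bullet> y"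
        by (intro tendsto_intros K.tendsto)
      moreover have "(\<lambda>n. \<Sum>k<n. (x $$ k) * b k) \<longlonglongrightarrow> x \<bullet> a"
        unfolding inner_ell2_def a[symmetric] by (rule summable_LIMSEQ[OF summable_ell2_mult])
      ultimately show ?thesis unfolding fin by (rule LIMSEQ_unique)
    qed
    then show ?thesis by blast
  qed
  then have "\<forall>y. \<exists>a. \<forall>x. K x \<bullet> y = x \<bullet> a" by blast
  then obtain A where "\<forall>y x. K x \<bullet> y = x \<bullet> A y" unfolding choice_iff by blast
  then have A: "\<forall>x y. K x \<bullet> y = x \<bullet> A y" by blast
  then show ?thesis using adjoint_unique[OF A] by simp
qed

text \<open>The values lie in \<^typ>\<open>ennreal\<close>, so \<open>\<Psi>\<close> is \<open>\<infinity>\<close> where the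
  penalty sum diverges. Since \<^const>\<open>ennreal\<close> sends negative reals to \<open>0\<close>, this is the
  intended functional only for \<open>\<alpha> > 0\<close> and nonnegative weights.\<close>

definition Psi ::
    "(ell2 \<Rightarrow> 'y::real_normed_vector) \<Rightarrow> (nat \<Rightarrow> real) \<Rightarrow> real \<Rightarrow> real \<Rightarrow> 'y \<Rightarrow> ell2 \<Rightarrow> ennreal"
  where "Psi K w p \<alpha> g u =
    ennreal ((norm (K u - g))\<^sup>2) + ennreal \<alpha> * (\<Sum>k. ennreal (w k * \<bar>u $$ k\<bar> powr p))"

end

theory Submission
  imports Defs
begin

text \<open>On \<open>[-B, B]\<close> the function \<open>\<bar>t\<bar>\<^sup>p\<close> with \<open>1 < p \<le> 2\<close> is strongly convex, with
  modulus \<open>p (p - 1) B\<^bsup>p-2\<^esup>\<close>. Summing over the coordinates, the Bregman distance of the penalty at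
  \<open>u\<^sup>+\<close> dominates a multiple of the squared \<open>\<ell>\<^sup>2\<close> distance on every coordinatewise bounded set. The
  source condition says that the subgradient of the penalty at \<open>u\<^sup>+\<close> is \<open>p K\<^sup>* \<theta>\<close>, so comparing
  \<open>\<Psi>(u)\<close> with \<open>\<Psi>(u\<^sup>+)\<close> and moving \<open>K\<^sup>*\<close> to the other side bounds this distance by
  \<open>\<delta>\<^sup>2/\<alpha> + \<delta> + \<alpha>\<close> up to constants. The same comparison gives the coordinatewise bound on the
  minimizers.\<close>

section \<open>Strong convexity of \<open>\<bar>t\<bar> powr p\<close> on bounded intervals\<close>

text \<open>The second derivative of \<open>t powr p\<close> minus its comparison quadratic is
  \<open>p * (p - 1)\<close> times \<open>x powr (p - 2) - B powr (p - 2)\<close>, nonnegative for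
  \<open>0 < x \<le> B\<close> because \<open>p - 2 \<le> 0\<close>.\<close>

lemma powr_deriv_minus_linear_mono:
  fixes p B s t :: real
  assumes p: "1 < p" "p \<le> 2" and "0 \<le> s" "s \<le> t" "t \<le> B"
  shows "p * s powr (p - 1) - p * (p - 1) * B powr (p - 2) * s
       \<le> p * t powr (p - 1) - p * (p - 1) * B powr (p - 2) * t"
\<comment> \<open>For \<open>p < 2\<close> the slope of \<open>x powr (p - 1)\<close> blows up at 0,
  so differentiability is used only in the open interval and continuity covers the
  endpoints.\<close>
proof (rule DERIV_nonneg_imp_increasing_open[OF \<open>s \<le> t\<close>])
  fix x assume x: "s < x" "x < t"
  then have x0: "0 < x" using assms by simp
  have "((\<lambda>x. p * x powr (p - 1) - p * (p - 1) * B powr (p - 2) * x) has_real_derivative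
      p * (p - 1) * (x powr (p - 2) - B powr (p - 2))) (at x)"
    using x0 by (auto intro!: derivative_eq_intros simp: algebra_simps)
  moreover have "B powr (p - 2) \<le> x powr (p - 2)"
    using x x0 assms by (intro powr_mono2') auto
  ultimately show "\<exists>y. ((\<lambda>x. p * x powr (p - 1) - p * (p - 1) * B powr (p - 2) * x)
      has_real_derivative y) (at x) \<and> 0 \<le> y"
    using p by (intro exI conjI) auto
next
  show "continuous_on {s..t} (\<lambda>x. p * x powr (p - 1) - p * (p - 1) * B powr (p - 2) * x)"
    using assms by (intro continuous_intros continuous_on_powr') auto
qed

text \<open>Subtracting the quadratic leaves a function \<open>h\<close> with monotone derivative;
  the claim is the tangent line inequality for \<open>h\<close> at \<open>a\<close>,
  rearranged.\<close>

lemma powr_strongly_convex_nonneg: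
  fixes p B a b :: real
  assumes p: "1 < p" "p \<le> 2" and a: "0 \<le> a" "a \<le> B" and b: "0 \<le> b" "b \<le> B"
  shows "p * (p - 1) / 2 * B powr (p - 2) * (b - a)\<^sup>2
       \<le> b powr p - a powr p - p * a powr (p - 1) * (b - a)"
proof -
  define k where "k = p * (p - 1) * B powr (p - 2)"
  define h where "h t = t powr p - k / 2 * t\<^sup>2" for t
  define h' where "h' t = p * t powr (p - 1) - k * t" for t
  have mono: "h' s \<le> h' t" if "0 \<le> s" "s \<le> t" "t \<le> B" for s t
    unfolding h'_def k_def using powr_deriv_minus_linear_mono[OF p that] .
  have cont: "continuous_on {s..t} h" if "0 \<le> s" for s t
    unfolding h_def using that p by (intro continuous_intros continuous_on_powr') auto
  have der: "(h has_real_derivative h' t) (at t)" if "0 < t" for t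
    unfolding h_def h'_def using that by (auto intro!: derivative_eq_intros)
  \<comment> \<open>\<open>der\<close> covers positive arguments only. The mean value theorem needs
    interior points only, so \<open>s = 0\<close> is allowed; monotonicity of \<open>h'\<close>
    later trades the intermediate point for \<open>a\<close>.\<close>
  have mvt: "\<exists>x. s < x \<and> x < t \<and> h t - h s = (t - s) * h' x" if "0 \<le> s" "s < t" for s t
  proof -
    have d: "h differentiable (at x)" if "s < x" for x
      using der[of x] that \<open>0 \<le> s\<close> by (auto intro: differentiableI simp: real_differentiable_def)
    obtain l z where z: "s < z" "z < t" "(h has_real_derivative l) (at z)" "h t - h s = (t - s) * l"
      using MVT[OF \<open>s < t\<close> cont[OF \<open>0 \<le> s\<close>]] d by blast
    moreover have "l = h' z"
      using DERIV_unique[OF z(3) der] z(1) \<open>0 \<le> s\<close> by simp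
    ultimately show ?thesis by blast
  qed
  have "h' a * (b - a) \<le> h b - h a"
  proof -
    consider "a < b" | "b < a" | "a = b" by linarith
    then show ?thesis
    proof cases
      case 1
      then obtain x where "a < x" "x < b" "h b - h a = (b - a) * h' x" using mvt a by blast
      then show ?thesis using mono[of a x] a b 1 by (simp add: mult.commute)
    next
      case 2
      then obtain x where x: "b < x" "x < a" "h a - h b = (a - b) * h' x" using mvt b by blast
      then have "(a - b) * h' x \<le> (a - b) * h' a"
        using mono[of x a] a b 2 by (intro mult_left_mono) auto
      then show ?thesis using x by (simp add: algebra_simps)
    qed simp
  qed
  moreover have "h b - h a - h' a * (b - a)
      = b powr p - a powr p - p * a powr (p - 1) * (b - a) - k / 2 * (b - a)\<^sup>2"
    unfolding h_def h'_def by (simp add: power2_eq_square field_simps)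
  ultimately show ?thesis unfolding k_def by simp
qed

text \<open>The reflection \<open>t \<mapsto> - t\<close> reduces to a nonnegative base point
  \<open>a\<close>; what remains new is the case where \<open>b\<close> has the opposite
  sign.\<close>

lemma abs_powr_strongly_convex:
  fixes p B a b :: real
  assumes p: "1 < p" "p \<le> 2" and a: "\<bar>a\<bar> \<le> B" and b: "\<bar>b\<bar> \<le> B"
  shows "p * (p - 1) / 2 * B powr (p - 2) * (b - a)\<^sup>2
       \<le> \<bar>b\<bar> powr p - \<bar>a\<bar> powr p - p * (sgn a * \<bar>a\<bar> powr (p - 1)) * (b - a)"
proof -
  define q where "q = p * (p - 1) / 2 * B powr (p - 2)"
  have nonneg: "q * (d - c)\<^sup>2 \<le> \<bar>d\<bar> powr p - c powr p - p * c powr (p - 1) * (d - c)"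
    if "0 \<le> c" "c \<le> B" "\<bar>d\<bar> \<le> B" for c d
  proof (cases "0 \<le> d")
    case True
    then show ?thesis using powr_strongly_convex_nonneg[OF p, of c B d] that by (simp add: q_def)
  next
    case False
    \<comment> \<open>Reflecting \<open>d\<close> to \<open>- d\<close> changes the two sides by multiples of \<open>- d\<close>, and these
      compare because the modified derivative is nonnegative at \<open>c\<close>.\<close>
    have "q * (- d - c)\<^sup>2 \<le> (- d) powr p - c powr p - p * c powr (p - 1) * (- d - c)"
      using powr_strongly_convex_nonneg[OF p, of c B "- d"] that False by (simp add: q_def)
    moreover have "2 * q * c \<le> p * c powr (p - 1)"
      using powr_deriv_minus_linear_mono[OF p, of 0 c B] that by (simp add: q_def)
    then have "2 * (- d) * (2 * q * c) \<le> 2 * (- d) * (p * c powr (p - 1))"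
      using False by (intro mult_left_mono) auto
    moreover have "q * (d - c)\<^sup>2 = q * (- d - c)\<^sup>2 + 2 * (- d) * (2 * q * c)"
      by (simp add: power2_eq_square algebra_simps)
    moreover have "p * c powr (p - 1) * (d - c)
        = p * c powr (p - 1) * (- d - c) - 2 * (- d) * (p * c powr (p - 1))"
      by (simp add: algebra_simps)
    ultimately have "q * (d - c)\<^sup>2 \<le> (- d) powr p - c powr p - p * c powr (p - 1) * (d - c)"
      by linarith
    then show ?thesis using False by simp
  qed
  show ?thesis
  proof (cases "0 \<le> a")
    case True
    \<comment> \<open>At \<open>a = 0\<close> the sign is 0 instead of 1, but
      \<open>0 powr (p - 1) = 0\<close> kills the linear term anyway.\<close>
    then show ?thesis using nonneg[of a b] a b by (cases "a = 0") (auto simp: q_def)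
  next
    case False
    have "q * (- b - - a)\<^sup>2 \<le> \<bar>- b\<bar> powr p - (- a) powr p - p * (- a) powr (p - 1) * (- b - - a)"
      using nonneg[of "- a" "- b"] a b False by simp
    moreover have "(- b - - a)\<^sup>2 = (b - a)\<^sup>2" by (simp add: power2_eq_square algebra_simps)
    ultimately show ?thesis using False by (simp add: q_def algebra_simps)
  qed
qed

section \<open>The Bregman distance of the penalty\<close>

text \<open>Weight the scalar inequality by \<open>w k \<ge> w\<^sub>0\<close> and sum over
  \<open>k\<close>. The series may be split because both penalties converge and
  \<open>(u - v) \<bullet> x\<close> is a pairing in \<open>ell2\<close>;
  \<open>p *\<^sub>R x\<close> is the subgradient at \<open>v\<close>.\<close>

lemma penalty_bregman_lower_bound:
  fixes u v x :: ell2 and w :: "nat \<Rightarrow> real"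
  assumes p: "1 < p" "p \<le> 2" and w: "0 < w\<^sub>0" "\<And>k. w\<^sub>0 \<le> w k"
    and x: "\<And>k. w k * sgn (v $$ k) * \<bar>v $$ k\<bar> powr (p - 1) = x $$ k"
    and sum_u: "summable (\<lambda>k. w k * \<bar>u $$ k\<bar> powr p)"
    and sum_v: "summable (\<lambda>k. w k * \<bar>v $$ k\<bar> powr p)"
    and u: "\<And>k. \<bar>u $$ k\<bar> \<le> B" and v: "\<And>k. \<bar>v $$ k\<bar> \<le> B"
  shows "w\<^sub>0 * (p * (p - 1) / 2 * B powr (p - 2)) * (norm (u - v))\<^sup>2
       \<le> (\<Sum>k. w k * \<bar>u $$ k\<bar> powr p) - (\<Sum>k. w k * \<bar>v $$ k\<bar> powr p) - p * ((u - v) \<bullet> x)"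
proof -
  define q where "q = p * (p - 1) / 2 * B powr (p - 2)"
  have q: "0 \<le> q" unfolding q_def using p by simp
  let ?r = "\<lambda>k. w k * \<bar>u $$ k\<bar> powr p - w k * \<bar>v $$ k\<bar> powr p - p * ((u - v) $$ k * x $$ k)"
  have le: "w\<^sub>0 * q * ((u - v) $$ k)\<^sup>2 \<le> ?r k" for k
  proof -
    have "w\<^sub>0 * (q * ((u - v) $$ k)\<^sup>2) \<le> w k * (q * ((u - v) $$ k)\<^sup>2)"
      using w q by (intro mult_right_mono) auto
    also have "\<dots> \<le> w k * (\<bar>u $$ k\<bar> powr p - \<bar>v $$ k\<bar> powr p
        - p * (sgn (v $$ k) * \<bar>v $$ k\<bar> powr (p - 1)) * (u $$ k - v $$ k))"
      using abs_powr_strongly_convex[OF p v u, of k k] less_le_trans[OF w(1) w(2)[of k]]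
      by (intro mult_left_mono) (auto simp: q_def)
    also have "\<dots> = ?r k" by (simp add: x[symmetric] algebra_simps)
    finally show ?thesis by (simp add: mult.assoc)
  qed
  have "w\<^sub>0 * q * (norm (u - v))\<^sup>2 = (\<Sum>k. w\<^sub>0 * q * ((u - v) $$ k)\<^sup>2)"
    unfolding norm_ell2_sq by (rule suminf_mult[symmetric, OF summable_ell2_power2])
  also have "\<dots> \<le> suminf ?r"
    by (intro suminf_le le summable_mult summable_ell2_power2 summable_diff sum_u sum_v
        summable_ell2_mult)
  also have "\<dots> = (\<Sum>k. w k * \<bar>u $$ k\<bar> powr p) - (\<Sum>k. w k * \<bar>v $$ k\<bar> powr p)
      - p * ((u - v) \<bullet> x)"
    unfolding inner_ell2_def
    by (simp only: suminf_diff[symmetric] suminf_mult[symmetric] summable_diff summable_mult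
        sum_u sum_v summable_ell2_mult)
  finally show ?thesis unfolding q_def .
qed

text \<open>Each penalty term equals \<open>x $$ k * v $$ k\<close>, a product of square-summable
  sequences. Thus the source condition itself makes the penalty finite at the exact
  solution.\<close>

lemma summable_penalty_of_subgradient:
  fixes v x :: ell2 and w :: "nat \<Rightarrow> real"
  assumes p: "1 < p"
    and x: "\<And>k. w k * sgn (v $$ k) * \<bar>v $$ k\<bar> powr (p - 1) = x $$ k"
  shows "summable (\<lambda>k. w k * \<bar>v $$ k\<bar> powr p)"
proof -
  have "w k * \<bar>v $$ k\<bar> powr p = x $$ k * v $$ k" for k
  proof (cases "v $$ k = 0")
    case False
    have "\<bar>v $$ k\<bar> powr p = \<bar>v $$ k\<bar> powr (p - 1) * \<bar>v $$ k\<bar>"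
      using False by (simp add: powr_diff)
    then show ?thesis unfolding x[symmetric] by (simp add: abs_sgn mult_ac)
  qed simp
  then show ?thesis using summable_ell2_mult[of x v] by simp
qed

section \<open>Minimality in real terms and coordinate bounds\<close>

lemma Psi_eq_ennreal:
  assumes "0 \<le> \<alpha>" and "\<And>k. 0 \<le> w k" and "summable (\<lambda>k. w k * \<bar>u $$ k\<bar> powr p)"
  shows "Psi K w p \<alpha> g u = ennreal ((norm (K u - g))\<^sup>2 + \<alpha> * (\<Sum>k. w k * \<bar>u $$ k\<bar> powr p))"
  unfolding Psi_def using assms
  by (subst suminf_ennreal2) (auto simp: ennreal_mult'' ennreal_plus suminf_nonneg)

text \<open>Positivity of \<alpha> matters: in \<open>ennreal\<close>, \<open>0 * top = 0\<close>
  would hide a divergent penalty.\<close>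

lemma Psi_finite_imp_summable:
  assumes "0 < \<alpha>" and "\<And>k. 0 \<le> w k" and "Psi K w p \<alpha> g u < \<infinity>"
  shows "summable (\<lambda>k. w k * \<bar>u $$ k\<bar> powr p)"
proof (rule summable_suminf_not_top)
  show "(\<Sum>k. ennreal (w k * \<bar>u $$ k\<bar> powr p)) \<noteq> top"
    using assms(1,3) unfolding Psi_def by (auto simp: ennreal_mult_eq_top_iff)
qed (use assms in simp)

text \<open>A competitor with finite penalty forces a finite value at the minimizer, so the
  comparison of extended values becomes one of reals.\<close>

lemma Psi_minimizer_le:
  assumes "0 < \<alpha>" and w: "\<And>k. 0 \<le> w k"
    and min: "is_arg_min (Psi K w p \<alpha> g) (\<lambda>_. True) u"
    and v: "summable (\<lambda>k. w k * \<bar>v $$ k\<bar> powr p)"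
  shows "summable (\<lambda>k. w k * \<bar>u $$ k\<bar> powr p)"
    and "(norm (K u - g))\<^sup>2 + \<alpha> * (\<Sum>k. w k * \<bar>u $$ k\<bar> powr p)
       \<le> (norm (K v - g))\<^sup>2 + \<alpha> * (\<Sum>k. w k * \<bar>v $$ k\<bar> powr p)"
proof -
  have a: "0 \<le> \<alpha>" using assms by simp
  have le: "Psi K w p \<alpha> g u \<le> Psi K w p \<alpha> g v"
    using min by (auto simp: is_arg_min_def not_less)
  also have "\<dots> < \<infinity>" unfolding Psi_eq_ennreal[OF a w v] by simp
  finally show u: "summable (\<lambda>k. w k * \<bar>u $$ k\<bar> powr p)"
    using Psi_finite_imp_summable assms by blast
  have "0 \<le> (norm (K v - g))\<^sup>2 + \<alpha> * (\<Sum>k. w k * \<bar>v $$ k\<bar> powr p)"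
    using a w v by (intro add_nonneg_nonneg mult_nonneg_nonneg suminf_nonneg) auto
  then show "(norm (K u - g))\<^sup>2 + \<alpha> * (\<Sum>k. w k * \<bar>u $$ k\<bar> powr p)
       \<le> (norm (K v - g))\<^sup>2 + \<alpha> * (\<Sum>k. w k * \<bar>v $$ k\<bar> powr p)"
    using le unfolding Psi_eq_ennreal[OF a w v] Psi_eq_ennreal[OF a w u]
    by (simp add: ennreal_le_iff)
qed

lemma abs_nth_le_of_penalty_le:
  fixes u :: ell2
  assumes p: "0 < p" and w: "0 < w\<^sub>0" "\<And>k. w\<^sub>0 \<le> w k"
    and u: "summable (\<lambda>k. w k * \<bar>u $$ k\<bar> powr p)" "(\<Sum>k. w k * \<bar>u $$ k\<bar> powr p) \<le> M"
  shows "\<bar>u $$ k\<bar> \<le> (M / w\<^sub>0) powr (1 / p)"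
proof -
  have w': "0 \<le> w k" for k using w(1) w(2)[of k] by simp
  have "w\<^sub>0 * \<bar>u $$ k\<bar> powr p \<le> w k * \<bar>u $$ k\<bar> powr p"
    using w by (intro mult_right_mono) auto
  also have "\<dots> \<le> (\<Sum>k. w k * \<bar>u $$ k\<bar> powr p)"
    using sum_le_suminf[OF u(1), of "{k}"] w' by simp
  finally have "\<bar>u $$ k\<bar> powr p \<le> M / w\<^sub>0" using w u(2) by (simp add: field_simps)
  then have "(\<bar>u $$ k\<bar> powr p) powr (1 / p) \<le> (M / w\<^sub>0) powr (1 / p)"
    using p by (intro powr_mono2) auto
  then show ?thesis using p by (simp add: powr_powr)
qed

section \<open>Error estimate and convergence rate\<close>

text \<open>An estimate at a single noise level. The bound \<open>M\<close> is left free so that one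
  value can serve all small \<delta>, keeping the factor on the left fixed.\<close>

lemma minimizer_error_bound:
  fixes K :: "ell2 \<Rightarrow> 'y::real_inner" and u v :: ell2 and w :: "nat \<Rightarrow> real"
  assumes K: "bounded_linear K"
    and p: "1 < p" "p \<le> 2" and w: "0 < w\<^sub>0" "\<And>k. w\<^sub>0 \<le> w k"
    and src: "\<And>k. w k * sgn (v $$ k) * \<bar>v $$ k\<bar> powr (p - 1) = adjoint K \<theta> $$ k"
    and \<delta>: "norm (K v - g) \<le> \<delta>" and \<alpha>: "0 < \<alpha>"
    and min: "is_arg_min (Psi K w p \<alpha> g) (\<lambda>_. True) u"
    and M: "\<delta>\<^sup>2 / \<alpha> + (\<Sum>k. w k * \<bar>v $$ k\<bar> powr p) \<le> M"
  shows "w\<^sub>0 * (p * (p - 1) / 2 * ((M / w\<^sub>0) powr (1 / p)) powr (p - 2)) * (norm (u - v))\<^sup>2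
       \<le> \<delta>\<^sup>2 / \<alpha> + p * norm \<theta> * \<delta> + (p * norm \<theta>)\<^sup>2 / 4 * \<alpha>"
proof -
  interpret K: bounded_linear K by (rule K)
  define R where "R u = (\<Sum>k. w k * \<bar>u $$ k\<bar> powr p)" for u :: ell2
  define B where "B = (M / w\<^sub>0) powr (1 / p)"
  define e where "e = w\<^sub>0 * (p * (p - 1) / 2 * B powr (p - 2)) * (norm (u - v))\<^sup>2"
  define T where "T = p * norm \<theta>"
  have w': "0 \<le> w k" for k using w(1) w(2)[of k] by simp
  have sum_v: "summable (\<lambda>k. w k * \<bar>v $$ k\<bar> powr p)"
    by (rule summable_penalty_of_subgradient[OF p(1) src])
  note sum_u = Psi_minimizer_le(1)[OF \<alpha> w' min sum_v]
  have le: "(norm (K u - g))\<^sup>2 + \<alpha> * R u \<le> (norm (K v - g))\<^sup>2 + \<alpha> * R v"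
    unfolding R_def by (rule Psi_minimizer_le(2)[OF \<alpha> w' min sum_v])
  have sq: "(norm (K v - g))\<^sup>2 \<le> \<delta>\<^sup>2" using \<delta> by (intro power_mono) auto
  \<comment> \<open>Dropping the residual of \<open>u\<close> bounds both penalties by
    \<open>M\<close>, hence both sequences coordinatewise by the same \<open>B\<close>.\<close>
  have "\<alpha> * R u \<le> \<delta>\<^sup>2 + \<alpha> * R v" using le sq zero_le_power2[of "norm (K u - g)"] by linarith
  then have "R u \<le> \<delta>\<^sup>2 / \<alpha> + R v" using \<alpha> by (simp add: field_simps)
  then have Ru: "R u \<le> M" using M unfolding R_def by simp
  have "0 \<le> \<delta>\<^sup>2 / \<alpha>" using \<alpha> by simp
  then have Rv: "R v \<le> M" using M unfolding R_def by linarith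
  have u_le: "\<bar>u $$ k\<bar> \<le> B" and v_le: "\<bar>v $$ k\<bar> \<le> B" for k
    using abs_nth_le_of_penalty_le[where w\<^sub>0 = w\<^sub>0 and p = p and w = w and M = M, OF _ w] p
      sum_u sum_v Ru Rv
    unfolding B_def R_def by auto
  have e: "e \<le> R u - R v - p * ((u - v) \<bullet> adjoint K \<theta>)"
    unfolding e_def R_def
    by (rule penalty_bregman_lower_bound[OF p w src sum_u sum_v u_le v_le])
  have "(u - v) \<bullet> adjoint K \<theta> = (K u - g) \<bullet> \<theta> - (K v - g) \<bullet> \<theta>"
    by (simp add: adjoint_ell2_works[OF K, symmetric] K.diff inner_diff_left)
  moreover have "- ((K u - g) \<bullet> \<theta>) \<le> norm (K u - g) * norm \<theta>"
    using norm_cauchy_schwarz[of "- (K u - g)" \<theta>] by (simp only: inner_minus_left norm_minus_cancel)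
  moreover have "(K v - g) \<bullet> \<theta> \<le> \<delta> * norm \<theta>"
    using norm_cauchy_schwarz[of "K v - g" \<theta>] mult_right_mono[OF \<delta>, of "norm \<theta>"] by simp
  ultimately have "- ((u - v) \<bullet> adjoint K \<theta>) \<le> (norm (K u - g) + \<delta>) * norm \<theta>"
    by (simp add: algebra_simps)
  then have "p * (- ((u - v) \<bullet> adjoint K \<theta>)) \<le> p * ((norm (K u - g) + \<delta>) * norm \<theta>)"
    using p by (intro mult_left_mono) auto
  then have "e \<le> R u - R v + T * (norm (K u - g) + \<delta>)"
    using e by (simp add: T_def algebra_simps)
  then have "\<alpha> * e \<le> \<alpha> * (R u - R v + T * (norm (K u - g) + \<delta>))"
    using \<alpha> by (intro mult_left_mono) auto
  \<comment> \<open>Completing the square: the residual term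
    \<open>\<alpha> * T * norm (K u - g)\<close> is absorbed by the squared residual in
    \<open>le\<close>, at the cost of \<open>\<alpha>\<^sup>2 * T\<^sup>2 / 4\<close>.\<close>
  moreover have "0 \<le> (norm (K u - g) - \<alpha> * T / 2)\<^sup>2" by simp
  ultimately have "\<alpha> * e \<le> \<delta>\<^sup>2 + \<alpha> * T * \<delta> + \<alpha> * \<alpha> * (T\<^sup>2 / 4)"
    using le sq by (simp add: power2_eq_square algebra_simps)
  then have "e \<le> \<delta>\<^sup>2 / \<alpha> + T * \<delta> + T\<^sup>2 / 4 * \<alpha>"
    using \<alpha> by (simp add: field_simps)
  then show ?thesis unfolding e_def B_def T_def .
qed

theorem corollary3p2:
  fixes K :: "ell2 \<Rightarrow> 'y::{real_inner, complete_space}"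
    and w :: "nat \<Rightarrow> real" and w\<^sub>0 p :: real
    and u_plus :: ell2 and g_plus \<theta> :: 'y
    and \<alpha> :: "real \<Rightarrow> real" and g :: "real \<Rightarrow> 'y" and u :: "real \<Rightarrow> ell2"
  assumes "bounded_linear K"
    and "1 < p" and "p \<le> 2"
    and "0 < w\<^sub>0" and "\<And>k. w\<^sub>0 \<le> w k"
    and "K u_plus = g_plus"
    and "\<And>k. w k * sgn (u_plus $$ k) * \<bar>u_plus $$ k\<bar> powr (p - 1) = adjoint K \<theta> $$ k"
    and "\<And>\<delta>. 0 < \<delta> \<Longrightarrow> norm (g_plus - g \<delta>) \<le> \<delta>"
    and "\<And>\<delta>. 0 < \<delta> \<Longrightarrow> 0 < \<alpha> \<delta>"
    and "\<And>\<delta>. 0 < \<delta> \<Longrightarrow> is_arg_min (Psi K w p (\<alpha> \<delta>) (g \<delta>)) (\<lambda>_. True) (u \<delta>)"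
    and "\<exists>c C. 0 < c \<and> c \<le> C \<and> (\<forall>\<^sub>F \<delta> in at_right 0. c * \<delta> \<le> \<alpha> \<delta> \<and> \<alpha> \<delta> \<le> C * \<delta>)"
  shows "(\<lambda>\<delta>. norm (u \<delta> - u_plus)) \<in> O[at_right 0](\<lambda>\<delta>. sqrt \<delta>)"
proof -
  obtain c C where c: "0 < c" and \<alpha>: "\<forall>\<^sub>F \<delta> in at_right 0. c * \<delta> \<le> \<alpha> \<delta> \<and> \<alpha> \<delta> \<le> C * \<delta>"
    using assms(11) by blast
  define R where "R = (\<Sum>k. w k * \<bar>u_plus $$ k\<bar> powr p)"
  \<comment> \<open>For \<delta> < 1 the lower bound on \<open>\<alpha> \<delta>\<close> gives
    \<open>\<delta>\<^sup>2 / \<alpha> \<delta> \<le> \<delta> / c \<le> 1 / c\<close>, so this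
    \<open>M\<close> is uniform in \<delta>.\<close>
  define M where "M = 1 / c + R"
  define q where "q = w\<^sub>0 * (p * (p - 1) / 2 * ((M / w\<^sub>0) powr (1 / p)) powr (p - 2))"
  \<comment> \<open>The three terms of the error bound, each at most a constant times \<delta>: the
    first by the lower bound on \<open>\<alpha> \<delta>\<close>, the last by the upper one.\<close>
  define D where "D = 1 / c + p * norm \<theta> + (p * norm \<theta>)\<^sup>2 / 4 * C"
  have w: "0 \<le> w k" for k using assms(4) assms(5)[of k] by simp
  have "0 \<le> R" unfolding R_def
    using w summable_penalty_of_subgradient[OF assms(2,7)] by (intro suminf_nonneg) auto
  \<comment> \<open>Strict positivity is essential: \<open>0 powr (1 / p) = 0\<close> would make
    \<open>q\<close> vanish, and \<open>q\<close> is divided by below.\<close>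
  then have "0 < M" using c unfolding M_def by (simp add: add_pos_nonneg)
  then have q: "0 < q" unfolding q_def using assms(2,4) by simp
  have "\<forall>\<^sub>F \<delta> in at_right 0. 0 < \<delta> \<and> \<delta> < (1::real)"
    using eventually_at_right_real[of 0 "1::real"] by simp
  with \<alpha> have "\<forall>\<^sub>F \<delta> in at_right 0. norm (norm (u \<delta> - u_plus)) \<le> sqrt (D / q) * norm (sqrt \<delta>)"
  proof eventually_elim
    case (elim \<delta>)
    then have \<delta>: "0 < \<delta>" "\<delta> < 1" and al: "c * \<delta> \<le> \<alpha> \<delta>" "\<alpha> \<delta> \<le> C * \<delta>" by auto
    note pos = assms(9)[OF \<delta>(1)]
    have "\<delta>\<^sup>2 / \<alpha> \<delta> \<le> \<delta>\<^sup>2 / (c * \<delta>)"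
      using al c \<delta> pos by (intro divide_left_mono) auto
    then have d: "\<delta>\<^sup>2 / \<alpha> \<delta> \<le> \<delta> / c" using \<delta> by (simp add: power2_eq_square)
    have "\<delta> / c \<le> 1 / c" using \<delta> c by (intro divide_right_mono) auto
    then have M: "\<delta>\<^sup>2 / \<alpha> \<delta> + (\<Sum>k. w k * \<bar>u_plus $$ k\<bar> powr p) \<le> M"
      using d unfolding M_def R_def by linarith
    have noise: "norm (K u_plus - g \<delta>) \<le> \<delta>" using assms(6,8) \<delta> by simp
    have "q * (norm (u \<delta> - u_plus))\<^sup>2
        \<le> \<delta>\<^sup>2 / \<alpha> \<delta> + p * norm \<theta> * \<delta> + (p * norm \<theta>)\<^sup>2 / 4 * \<alpha> \<delta>"
      unfolding q_def
      by (rule minimizer_error_bound[OF assms(1-5,7) noise pos assms(10)[OF \<delta>(1)] M])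
    also have "\<dots> \<le> \<delta> / c + p * norm \<theta> * \<delta> + (p * norm \<theta>)\<^sup>2 / 4 * (C * \<delta>)"
      using d al by (intro add_mono mult_left_mono order_refl) auto
    also have "\<dots> = D * \<delta>" unfolding D_def by (simp add: algebra_simps)
    finally have "(norm (u \<delta> - u_plus))\<^sup>2 \<le> D / q * \<delta>" using q by (simp add: field_simps)
    then have "norm (u \<delta> - u_plus) \<le> sqrt (D / q * \<delta>)" by (rule real_le_rsqrt)
    then show ?case using \<delta> by (simp only: real_sqrt_mult) simp
  qed
  then show ?thesis by (rule bigoI)
qed

end
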